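(* Let $\theta_{RNC}=\{UPR,\,RPU\}$, a set of meta-paths of the tripartite preference graph (TPG), and let $g_{RNC}$ be the projection of TPG over $\theta_{RNC}$. Then the set of all recommendation meta-paths (from $U$ to $R$) in $g_{RNC}$, each read as a meta-path of TPG by expanding every edge of the schema of $g_{RNC}$ into the meta-path of $\theta_{RNC}$ it represents, is the set of meta-paths described by the string description $$strdesc_{RNC}=UP(RPUPR)^* .$$
   Context: TPG schema. The tripartite preference graph (TPG) is a graph with three node types: $U$ (users), $P$ (pairwise preferences), $R$ (item representatives). Its undirected edges join users to preferences and preferences to representatives. Its network schema is therefore the directed graph on the vertex set $\{U,P,R\}$ with edges $(U,P),(P,U),(P,R),(R,P)$. Meta-paths. A meta-path of a network is a walk $v_1v_2\cdots v_n$ ($n\ge 1$) in its network schema, i.e. each $(v_i,v_{i+1})$ is an edge of the schema; it is written as the string $v_1v_2\cdots v_n$. A recommendation meta-path (for the query $(U,R)$) is a meta-path with $v_1=U$ and $v_n=R$. Projection. The projection of TPG over a finite set $\theta$ of meta-paths of TPG is a graph whose network schema has as vertices the starting and ending node types of the members of $\theta$, and as edges the pairs $(\pi.\mathrm{start},\pi.\mathrm{end})$ for $\pi\in\theta$. The edge $(\pi.\mathrm{start},\pi.\mathrm{end})$ represents the meta-path $\pi$ of TPG. For the $\theta$ used here, distinct members of $\theta$ give distinct edges. A meta-path of the projection is expanded into a meta-path of TPG by replacing each edge by the meta-path in $\theta$ that it represents and joining these consecutively. String descriptions. A string description denotes a set of strings over the node types. The join of strings $\alpha=t_1\cdots t_m$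 and $\beta=t'_1\cdots t'_n$ is defined when $t_m=t'_1$ and is $\alpha.\beta=t_1\cdots t_m t'_2\cdots t'_n$ (the shared node type is written once); joins of sets of strings are taken elementwise. If a string $\alpha$ starts and ends with the same type $t$, then $\alpha^*$ is the set of all joins of $k\ge 0$ copies of $\alpha$, where the join of $0$ copies is the one-letter string $t$. The expression $UP(RPUPR)^*$ abbreviates the join $UPR.\,(RPUPR)^*$, i.e. the strings obtained by prepending $UP$ to a string of $(RPUPR)^*$. *)

theory Defs
  imports Graph_Theory.Graph_Theory
begin

datatype node_type = U | P | R

definition tpg_schema :: "node_type pair_pre_digraph" where
  "tpg_schema = \<lparr> pverts = {U, P, R}, parcs = {(U, P), (P, U), (P, R), (R, P)} \<rparr>"

text \<open>A meta-path is a nonempty list of node types; nonemptiness is part of \<^const>\<open>vwalk\<close>.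
  The one-vertex walk is included.\<close>

definition meta_paths :: "'a pair_pre_digraph \<Rightarrow> 'a list set" where
  "meta_paths S = {p. vwalk p (with_proj S)}"

definition recommendation_meta_paths :: "node_type pair_pre_digraph \<Rightarrow> node_type list set" where
  "recommendation_meta_paths S = {p \<in> meta_paths S. hd p = U \<and> last p = R}"

definition path_ends :: "'a list \<Rightarrow> 'a \<times> 'a" where
  "path_ends \<pi> = (hd \<pi>, last \<pi>)"

text \<open>The network schema of the projection over \<open>\<theta>\<close>. It depends on the projected network
  only through the requirement that \<open>\<theta>\<close> is a set of meta-paths of that network.\<close>

definition projection :: "'a list set \<Rightarrow> 'a pair_pre_digraph" where
  "projection \<theta> = \<lparr> pverts = hd ` \<theta> \<union> last ` \<theta>, parcs = path_ends ` \<theta> \<rparr>"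

text \<open>The description is proper for the edges of the projection when \<^const>\<open>path_ends\<close>
  is injective on \<open>\<theta>\<close>.\<close>

definition represented :: "'a list set \<Rightarrow> 'a \<times> 'a \<Rightarrow> 'a list" where
  "represented \<theta> e = (THE \<pi>. \<pi> \<in> \<theta> \<and> path_ends \<pi> = e)"

text \<open>The operator \<open>\<oplus>\<close> is the library's join of vertex walks, \<open>p \<oplus> q = p @ tl q\<close>, which
  writes the shared vertex once.\<close>

fun expand :: "'a list set \<Rightarrow> 'a list \<Rightarrow> 'a list" where
  "expand \<theta> [] = []"
| "expand \<theta> [v] = [v]"
| "expand \<theta> (u # v # p) = represented \<theta> (u, v) \<oplus> expand \<theta> (v # p)"

definition join_sets :: "'a list set \<Rightarrow> 'a list set \<Rightarrow> 'a list set" where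
  "join_sets A B = {\<alpha> \<oplus> \<beta> | \<alpha> \<beta>. \<alpha> \<in> A \<and> \<beta> \<in> B \<and> joinable \<alpha> \<beta>}"

text \<open>Powers and star are meant for nonempty strings with equal first and last letter.\<close>

primrec join_power :: "'a list \<Rightarrow> nat \<Rightarrow> 'a list" where
  "join_power \<alpha> 0 = [hd \<alpha>]"
| "join_power \<alpha> (Suc k) = \<alpha> \<oplus> join_power \<alpha> k"

definition join_star :: "'a list \<Rightarrow> 'a list set" where
  "join_star \<alpha> = {join_power \<alpha> k | k. True}"

definition theta_RNC :: "node_type list set" where
  "theta_RNC = {[U, P, R], [R, P, U]}"

definition g_RNC :: "node_type pair_pre_digraph" where
  "g_RNC = projection theta_RNC"

definition strdesc_RNC :: "node_type list set" where
  "strdesc_RNC = join_sets {[U, P, R]} (join_star [R, P, U, P, R])"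

lemma theta_RNC_meta_paths: "theta_RNC \<subseteq> meta_paths tpg_schema"
  by (auto simp: theta_RNC_def meta_paths_def vwalk_def tpg_schema_def)

lemma inj_on_path_ends_theta_RNC: "inj_on path_ends theta_RNC"
  by (auto simp: theta_RNC_def path_ends_def)

end

theory Submission
  imports Defs
begin

text \<open>Every edge of the schema of \<open>g\<^sub>R\<^sub>N\<^sub>C\<close> switches between \<open>U\<close> and \<open>R\<close>, so a walk from \<open>U\<close> to
  \<open>R\<close> is one edge \<open>UR\<close> followed by \<open>k\<close> round trips \<open>RUR\<close>. The edge expands to \<open>UPR\<close>
  and each round trip to \<open>RPU.UPR = RPUPR\<close>.\<close>

text \<open>The initial \<open>U\<close> is left out so that this recursion runs parallel to that of
  \<open>join_power\<close> on \<open>[R, P, U, P, R]\<close>.\<close>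

fun round_trips :: "nat \<Rightarrow> node_type list" where
  "round_trips 0 = [R]"
| "round_trips (Suc k) = R # U # round_trips k"

lemma round_trips_Cons: "\<exists>t. round_trips k = R # t"
  by (cases k) auto

lemma vwalk_Cons_Cons_iff:
  "vwalk (u # v # p) G \<longleftrightarrow> u \<in> verts G \<and> (u, v) \<in> arcs_ends G \<and> vwalk (v # p) G"
  by (auto simp: vwalk_def)

lemma vwalk_singleton_iff: "vwalk [v] G \<longleftrightarrow> v \<in> verts G"
  by (auto simp: vwalk_def)

lemma pverts_g_RNC: "pverts g_RNC = {U, R}"
  by (auto simp: g_RNC_def projection_def theta_RNC_def)

lemma parcs_g_RNC: "parcs g_RNC = {(U, R), (R, U)}"
  by (auto simp: g_RNC_def projection_def theta_RNC_def path_ends_def)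

text \<open>The two members of \<open>theta_RNC\<close> start at different types, so each edge
  determines its \<open>THE\<close>.\<close>

lemma represented_theta_RNC:
  "represented theta_RNC (U, R) = [U, P, R]"
  "represented theta_RNC (R, U) = [R, P, U]"
  by (auto simp: represented_def theta_RNC_def path_ends_def intro!: the_equality)

lemma vwalk_g_RNC_round_trips: "vwalk (round_trips k) (with_proj g_RNC)"
proof (induction k)
  case (Suc k)
  then show ?case
    using round_trips_Cons[of k]
    by (auto simp: vwalk_Cons_Cons_iff pverts_g_RNC parcs_g_RNC)
qed (simp add: vwalk_singleton_iff pverts_g_RNC)

lemma last_round_trips: "last (round_trips k) = R"
proof (induction k)
  case (Suc k)
  then show ?case
    using round_trips_Cons[of k] by auto
qed simp

text \<open>Induction peels off two letters at a time: a walk leaving \<open>R\<close> must visit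
  \<open>U\<close> and come straight back to \<open>R\<close>.\<close>

lemma vwalk_g_RNC_eq_round_trips:
  assumes "vwalk p (with_proj g_RNC)" "hd p = R" "last p = R"
  shows "\<exists>k. p = round_trips k"
  using assms
proof (induction p rule: induct_list012)
  case 1
  then show ?case by (simp add: vwalk_def)
next
  case (2 v)
  then have "[v] = round_trips 0" by simp
  then show ?case ..
next
  case (3 u v p)
  \<comment> \<open>The walk cannot stop at \<open>v = U\<close>, because its last letter is
    \<open>R\<close>.\<close>
  then have "u = R" "v = U" and "p \<noteq> []"
    by (auto simp: vwalk_Cons_Cons_iff pverts_g_RNC parcs_g_RNC split: if_splits)
  moreover from this have "vwalk p (with_proj g_RNC)" "hd p = R" "last p = R"
    using 3 by (cases p; auto simp: vwalk_Cons_Cons_iff pverts_g_RNC parcs_g_RNC)+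
  ultimately obtain k where "u # v # p = round_trips (Suc k)"
    using "3.IH"(1) by auto
  then show ?case ..
qed

lemma recommendation_meta_paths_g_RNC:
  "recommendation_meta_paths g_RNC = range (\<lambda>k. U # round_trips k)"
proof (intro equalityI subsetI)
  fix p assume "p \<in> recommendation_meta_paths g_RNC"
  then have p: "vwalk p (with_proj g_RNC)" "hd p = U" "last p = R"
    by (auto simp: recommendation_meta_paths_def meta_paths_def)
  \<comment> \<open>A one-letter walk is excluded since its ends \<open>U\<close> and
    \<open>R\<close> differ.\<close>
  then obtain v q where pq: "p = U # v # q"
    by (cases p; cases "tl p") auto
  with p have "\<exists>k. v # q = round_trips k"
    by (intro vwalk_g_RNC_eq_round_trips) (auto simp: vwalk_Cons_Cons_iff parcs_g_RNC)
  with pq show "p \<in> range (\<lambda>k. U # round_trips k)" by auto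
next
  fix p assume "p \<in> range (\<lambda>k. U # round_trips k)"
  then obtain k where "p = U # round_trips k" by auto
  then show "p \<in> recommendation_meta_paths g_RNC"
    using round_trips_Cons[of k] vwalk_g_RNC_round_trips[of k] last_round_trips[of k]
    by (auto simp: recommendation_meta_paths_def meta_paths_def vwalk_Cons_Cons_iff
        pverts_g_RNC parcs_g_RNC)
qed

text \<open>A join drops the first letter of its right operand; knowing that letter gives
  joinability and the walk property across the seam.\<close>

lemma join_power_RPUPR_Cons: "\<exists>t. join_power [R, P, U, P, R] k = R # t"
  by (cases k) (auto simp: vwalk_join_def)

lemma expand_Cons_round_trips:
  "expand theta_RNC (U # round_trips k) = [U, P, R] \<oplus> expand theta_RNC (round_trips k)"
  using round_trips_Cons[of k] by (auto simp: represented_theta_RNC)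

text \<open>Zero round trips leave \<open>[R]\<close>, the zeroth power; each further one prepends
  \<open>[R, P, U]\<close> joined with \<open>[U, P, R]\<close>, which is one more copy of the
  base.\<close>

lemma expand_round_trips:
  "expand theta_RNC (round_trips k) = join_power [R, P, U, P, R] k"
  by (induction k)
    (simp_all add: expand_Cons_round_trips represented_theta_RNC vwalk_join_def)

lemma strdesc_RNC_eq:
  "strdesc_RNC = range (\<lambda>k. [U, P, R] \<oplus> join_power [R, P, U, P, R] k)"
proof -
  have "joinable [U, P, R] (join_power [R, P, U, P, R] k)" for k
    using join_power_RPUPR_Cons[of k] by (auto simp: joinable_def)
  then show ?thesis
    by (auto simp: strdesc_RNC_def join_sets_def join_star_def)
qed

lemma vwalk_tpg_schema_join_power:
  "vwalk (join_power [R, P, U, P, R] k) (with_proj tpg_schema)"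
proof (induction k)
  case (Suc k)
  then show ?case
    using join_power_RPUPR_Cons[of k]
    by (auto simp: vwalk_join_def vwalk_Cons_Cons_iff tpg_schema_def)
qed (simp add: vwalk_singleton_iff tpg_schema_def)

lemma strdesc_RNC_subset_meta_paths: "strdesc_RNC \<subseteq> meta_paths tpg_schema"
proof -
  have "vwalk ([U, P, R] \<oplus> join_power [R, P, U, P, R] k) (with_proj tpg_schema)" for k
    using join_power_RPUPR_Cons[of k] vwalk_tpg_schema_join_power[of k]
    by (auto simp: vwalk_join_def vwalk_Cons_Cons_iff tpg_schema_def)
  then show ?thesis
    by (auto simp: strdesc_RNC_eq meta_paths_def)
qed

theorem mainTheorem3:
  shows "expand theta_RNC ` recommendation_meta_paths g_RNC \<subseteq> meta_paths tpg_schema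
    \<and> expand theta_RNC ` recommendation_meta_paths g_RNC = strdesc_RNC"
proof -
  \<comment> \<open>Both sides are ranges over \<open>k\<close>, and they agree for each
    \<open>k\<close>.\<close>
  have "expand theta_RNC ` recommendation_meta_paths g_RNC = strdesc_RNC"
    by (simp add: recommendation_meta_paths_g_RNC strdesc_RNC_eq image_image
        expand_Cons_round_trips expand_round_trips)
  then show ?thesis
    using strdesc_RNC_subset_meta_paths by simp
qed

end
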